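(* Let $D$ be a bounded domain in $\mathbb{C}^n$ and $x\in D$. Let $(f_i)$ be a sequence of injective holomorphic maps from $D$ to $\mathbb{C}^n$ such that $f_i(x)=0\in\mathbb{C}^n$ for all $i$. Suppose $f_i$ converges to a map $f:D\rightarrow \mathbb{C}^n$ uniformly on compact subsets of $D$. If there exists a neighborhood $U$ of $0$ in $\mathbb{C}^n$ such that $U\subset f_i(D)$ for all $i$, then $f$ is injective.
   Context: A domain is a connected open set. *)

theory Defs
  imports "HOL-Analysis.Analysis"
begin

text \<open>Holomorphic maps of several complex variables: complex Frechet differentiability.
  The library's derivative is only real-linear, so complex linearity is required separately.\<close>

definition holomorphic_map_on ::
    "(complex ^ 'n \<Rightarrow> complex ^ 'm) \<Rightarrow> (complex ^ 'n) set \<Rightarrow> bool" where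
  "holomorphic_map_on f S \<longleftrightarrow>
     (\<forall>z\<in>S. \<exists>f'. (f has_derivative f') (at z within S) \<and> Vector_Spaces.linear (*s) (*s) f')"

definition domain_set :: "'a::topological_space set \<Rightarrow> bool" where
  "domain_set D \<longleftrightarrow> open D \<and> connected D"

end

theory Submission
  imports Defs "HOL-Complex_Analysis.Great_Picard"
begin

text \<open>
  Let \<open>F\<close> be injective and holomorphic on a bounded domain \<open>D\<close> and \<open>g\<close> its continuous inverse. At a
  regular value \<open>w\<close>, compare on a complex line through \<open>w\<close> the difference quotients \<open>\<phi>\<close> of \<open>g\<close> based at
  \<open>w\<close> with the Jacobian determinant \<open>H\<close> of \<open>F\<close>, transported by \<open>g\<close>: both are holomorphic off the
  zeros of \<open>H\<close> and continuous everywhere. The maximum principle for \<open>\<phi>\<^sup>n H\<close> with \<open>n \<rightarrow> \<infinity>\<close> (as in the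
  proof of Rado's theorem) bounds \<open>g'(w)\<close> by the diameter of \<open>D\<close> over the radius of a ball around \<open>w\<close>
  inside \<open>F(D)\<close>, so \<open>|det F'|\<close> is bounded below wherever it does not vanish. Hence its zero set is
  open and closed in \<open>D\<close>; it is not all of \<open>D\<close> by Sard's theorem and invariance of domain, so it is
  empty.

  For the sequence, the same bound at \<open>x\<close> is uniform in \<open>i\<close> because all images contain one ball around
  \<open>0\<close>; thus \<open>det f'(x) \<noteq> 0\<close>, and Hurwitz's theorem on complex lines spreads this to all of \<open>D\<close>.
  If \<open>f a = f b\<close> with \<open>a \<noteq> b\<close>, then invertibility of \<open>f'(a)\<close> and Brouwer's fixed point theorem make
  some \<open>F i\<close> take the value \<open>F i b\<close> near \<open>a\<close>, contradicting injectivity.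
\<close>

subsection \<open>Functions holomorphic along complex lines\<close>

lemma continuous_on_compact_norm_bound:
  assumes "continuous_on T f" "compact T"
  obtains M where "0 < M" "\<And>z. z \<in> T \<Longrightarrow> norm (f z) \<le> M"
  using compact_imp_bounded[OF compact_continuous_image[OF assms]] by (auto simp: bounded_pos)

lemma norm_vector_smult: "norm (c *s (v :: complex ^ 'n)) = cmod c * norm v"
  by (simp add: norm_vec_def norm_mult L2_set_left_distrib L2_set_right_distrib)

lemma norm_axis_complex: "norm (axis j 1 :: complex ^ 'n) = 1"
  by (simp add: norm_vec_def L2_set_def axis_def if_distrib[of norm]
      if_distrib[of "\<lambda>x. x ^ 2"] cong: if_cong)

lemma continuous_on_line [continuous_intros]:
  "continuous_on T g \<Longrightarrow> continuous_on T h \<Longrightarrow> continuous_on T (\<lambda>t. g t *s (h t :: complex ^ 'n))"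
  unfolding vector_scalar_mult_def by (intro continuous_intros)

text \<open>On open sets this amounts to complex Frechet differentiability
  (\<open>line_holo_has_derivative\<close>, \<open>line_holoI\<close>), in a form that feeds
  one-variable theorems directly and still makes sense on closed balls.\<close>

definition line_holo :: "(complex ^ 'n \<Rightarrow> complex) \<Rightarrow> (complex ^ 'n) set \<Rightarrow> bool" where
  "line_holo \<phi> S \<longleftrightarrow> continuous_on S \<phi> \<and>
     (\<forall>a v. (\<lambda>t. \<phi> (a + t *s v)) holomorphic_on {t. a + t *s v \<in> S})"

definition dirderiv :: "(complex ^ 'n \<Rightarrow> complex) \<Rightarrow> complex ^ 'n \<Rightarrow> complex ^ 'n \<Rightarrow> complex" where
  "dirderiv \<phi> u z = deriv (\<lambda>s. \<phi> (z + s *s u)) 0"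

text \<open>Built from one-variable derivatives so that its entries are again line-holomorphic; for
  line-holomorphic components on an open set it is the matrix of the Frechet derivative.\<close>

definition complex_jacobian :: "(complex ^ 'n \<Rightarrow> complex ^ 'm) \<Rightarrow> complex ^ 'n \<Rightarrow> complex ^ 'n ^ 'm" where
  "complex_jacobian F z = (\<chi> i j. dirderiv (\<lambda>w. F w $ i) (axis j 1) z)"

lemma line_holoD:
  assumes "line_holo \<phi> S"
  shows "continuous_on S \<phi>" "(\<lambda>t. \<phi> (a + t *s v)) holomorphic_on {t. a + t *s v \<in> S}"
  using assms by (auto simp: line_holo_def)

lemma line_holo_subset: "line_holo \<phi> S \<Longrightarrow> T \<subseteq> S \<Longrightarrow> line_holo \<phi> T"
  unfolding line_holo_def by (blast intro: continuous_on_subset holomorphic_on_subset)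

lemma open_line: "open S \<Longrightarrow> open {t. a + t *s (v :: complex ^ 'n) \<in> S}"
  using open_vimage[of S "\<lambda>t. a + t *s v"] by (simp add: vimage_def continuous_intros)

lemma dirderiv_line:
  assumes "open S" "line_holo \<phi> S" "a + t *s v \<in> S"
  shows "((\<lambda>t. \<phi> (a + t *s v)) has_field_derivative dirderiv \<phi> v (a + t *s v)) (at t)"
proof -
  let ?p = "\<lambda>t. \<phi> (a + t *s v)"
  have "?p field_differentiable at t"
    using line_holoD(2)[OF assms(2)] open_line[OF assms(1)] assms(3)
    by (metis (no_types, lifting) holomorphic_on_imp_differentiable_at mem_Collect_eq)
  then have d: "(?p has_field_derivative deriv ?p t) (at t)"
    by (simp add: DERIV_deriv_iff_field_differentiable)
  \<comment> \<open>Shifting the parameter from \<open>t\<close> to \<open>0\<close> matches the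
    base point in \<open>dirderiv\<close>.\<close>
  then have "((\<lambda>s. ?p (t + s)) has_field_derivative deriv ?p t) (at 0)"
    using DERIV_shift[of ?p "deriv ?p t" 0 t] by (simp add: add.commute)
  then have "dirderiv \<phi> v (a + t *s v) = deriv ?p t"
    unfolding dirderiv_def by (intro DERIV_imp_deriv) (simp add: vector_sadd_rdistrib add.assoc)
  with d show ?thesis by simp
qed

section \<open>Uniform estimates for difference quotients\<close>

text \<open>First-order Taylor formula. Discs of radius \<open>R / 2\<close> around points of
  \<open>cball 0 (R/2)\<close> stay in \<open>cball 0 R\<close>, so Cauchy's inequality bounds the
  second derivative by \<open>2 * M / (R/2)^2\<close>, whence the 8. Only \<open>M\<close> and
  \<open>R\<close> enter, so the estimate is uniform over families with a common bound.\<close>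

lemma cmod_diff_quotient_le:
  assumes "open T" "\<psi> holomorphic_on T" "cball 0 R \<subseteq> T" "0 < R"
    and "\<And>z. z \<in> cball 0 R \<Longrightarrow> cmod (\<psi> z) \<le> M" "s \<noteq> 0" "cmod s \<le> R / 2"
  shows "cmod ((\<psi> s - \<psi> 0) / s - deriv \<psi> 0) \<le> 8 * M / R\<^sup>2 * cmod s"
proof -
  have sub: "cball 0 (R/2) \<subseteq> T"
    using assms(3,4) by (auto simp: subset_iff)
  have "cmod ((deriv ^^ 0) \<psi> s - (\<Sum>i\<le>1. (deriv ^^ i) \<psi> 0 * (s-0) ^ i / (fact i)))
     \<le> (8 * M / R\<^sup>2) * cmod(s - 0)^(Suc 1) / fact 1"
  proof (rule complex_Taylor[of "cball 0 (R/2)"])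
    fix i and x :: complex assume "x \<in> cball 0 (R/2)"
    then have "x \<in> T" using sub by auto
    then show "((deriv ^^ i) \<psi> has_field_derivative (deriv ^^ Suc i) \<psi> x) (at x within cball 0 (R/2))"
      using holomorphic_derivI[OF holomorphic_higher_deriv[OF assms(2,1)] assms(1)] by simp
  next
    fix x assume x: "x \<in> cball (0::complex) (R/2)"
    have in_R: "cball x (R/2) \<subseteq> cball 0 R"
    proof
      fix y assume "y \<in> cball x (R/2)"
      with x show "y \<in> cball 0 R"
        using dist_triangle[of 0 y x] by auto
    qed
    have "cmod ((deriv ^^ 2) \<psi> x) \<le> fact 2 * M / (R/2)^2"
    proof (rule Cauchy_inequality)
      show "\<psi> holomorphic_on ball x (R/2)"
        using in_R assms(3) by (intro holomorphic_on_subset[OF assms(2)]) (auto simp: subset_iff)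
      show "continuous_on (cball x (R/2)) \<psi>"
        using in_R assms(3) by (intro holomorphic_on_imp_continuous_on holomorphic_on_subset[OF assms(2)]) auto
      fix y assume "cmod (x - y) = R/2"
      then have "y \<in> cball x (R/2)" by (simp add: dist_norm)
      then show "cmod (\<psi> y) \<le> M" using in_R assms(5) by blast
    qed (use assms in auto)
    also have "\<dots> = 8 * M / R\<^sup>2" by (simp add: power2_eq_square)
    finally show "cmod ((deriv ^^ Suc 1) \<psi> x) \<le> 8 * M / R\<^sup>2" by (simp add: numeral_2_eq_2)
  qed (use assms in auto)
  then have "cmod (\<psi> s - \<psi> 0 - s * deriv \<psi> 0) \<le> 8 * M / R\<^sup>2 * cmod s * cmod s"
    by (simp add: power2_eq_square algebra_simps)
  moreover have "(\<psi> s - \<psi> 0) / s - deriv \<psi> 0 = (\<psi> s - \<psi> 0 - s * deriv \<psi> 0) / s"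
    using assms(6) by (simp add: field_simps)
  ultimately show ?thesis using assms(6)
    by (simp add: norm_divide divide_le_eq)
qed

lemma line_in_cball:
  assumes "cmod s * norm u \<le> r - dist a z"
  shows "z + s *s u \<in> cball a r"
proof -
  have "dist a (z + s *s u) \<le> dist a z + norm (s *s u)"
    by (metis dist_triangle dist_add_cancel dist_0_norm add.right_neutral)
  then show ?thesis using assms by (simp add: norm_vector_smult)
qed

text \<open>One bound for \<open>\<phi>\<close> on a compact ball serves all lines through nearby
  points, so the one-variable estimate holds with constants independent of the base point.\<close>

lemma diff_quotient_uniform_bound:
  assumes "open S" "line_holo \<phi> S" "a \<in> S"
  obtains r C \<delta> where "0 < r" "cball a r \<subseteq> S" "0 < \<delta>" "0 \<le> C"
    "\<And>z s. z \<in> cball a r \<Longrightarrow> cmod s \<le> \<delta> \<Longrightarrow> z + s *s u \<in> S"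
    "\<And>z s. z \<in> cball a r \<Longrightarrow> s \<noteq> 0 \<Longrightarrow> cmod s \<le> \<delta> \<Longrightarrow>
       cmod ((\<phi> (z + s *s u) - \<phi> z) / s - dirderiv \<phi> u z) \<le> C * cmod s"
proof -
  obtain q where q: "0 < q" "cball a q \<subseteq> S"
    using assms open_contains_cball by blast
  \<comment> \<open>Half of \<open>q\<close> is reserved for the base point and half for the
    increment \<open>s *s u\<close>; the added 1 covers \<open>u = 0\<close>.\<close>
  define r R where "r = q/2" and "R = r / (norm u + 1)"
  have nu: "norm u + 1 > 0" by (simp add: add_nonneg_pos)
  have rR: "0 < r" "0 < R" using q nu by (auto simp: r_def R_def)
  obtain M where M: "0 < M" "\<And>z. z \<in> cball a q \<Longrightarrow> cmod (\<phi> z) \<le> M"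
    using continuous_on_compact_norm_bound[OF continuous_on_subset[OF line_holoD(1)[OF assms(2)] q(2)] compact_cball]
    by metis
  have inq: "z + s *s u \<in> cball a q" if "z \<in> cball a r" "cmod s \<le> R" for z s
  proof (rule line_in_cball)
    have "cmod s * norm u \<le> R * (norm u + 1)" using that rR by (intro mult_mono) auto
    also have "\<dots> = r" using nu by (simp add: R_def)
    finally show "cmod s * norm u \<le> q - dist a z" using that by (simp add: r_def)
  qed
  show ?thesis
  proof (rule that)
    show "0 < r" "0 < R/2" using rR by auto
    show "cball a r \<subseteq> S" using q by (auto simp: r_def subset_iff)
    show "0 \<le> 8 * M / R\<^sup>2" using M by simp
    show "z + s *s u \<in> S" if "z \<in> cball a r" "cmod s \<le> R/2" for z s
      using inq[of z s] that rR q by auto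
    fix z s assume *: "z \<in> cball a r" "s \<noteq> 0" "cmod s \<le> R / 2"
    have "cmod ((\<phi> (z + s *s u) - \<phi> (z + 0 *s u)) / s - deriv (\<lambda>s. \<phi> (z + s *s u)) 0) \<le> 8 * M / R\<^sup>2 * cmod s"
    proof (rule cmod_diff_quotient_le)
      show "open {t. z + t *s u \<in> S}" by (rule open_line[OF assms(1)])
      show "(\<lambda>s. \<phi> (z + s *s u)) holomorphic_on {t. z + t *s u \<in> S}" by (rule line_holoD(2)[OF assms(2)])
    qed (use inq[OF *(1)] q M rR * in auto)
    then show "cmod ((\<phi> (z + s *s u) - \<phi> z) / s - dirderiv \<phi> u z) \<le> 8 * M / R\<^sup>2 * cmod s"
      by (simp add: dirderiv_def)
  qed
qed

section \<open>Closure under limits, algebraic operations and differentiation\<close>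

text \<open>Weierstrass's theorem on each line. The approximants may depend on the point
  \<open>a\<close>, because difference quotients have an admissible step size only locally.\<close>

lemma line_holo_uniform_limit:
  assumes "open S"
    and "\<And>a. a \<in> S \<Longrightarrow> \<exists>r>0. \<exists>Q. cball a r \<subseteq> S \<and> (\<forall>n::nat. line_holo (Q n) (cball a r)) \<and>
            uniform_limit (cball a r) Q \<phi> sequentially"
  shows "line_holo \<phi> S"
  unfolding line_holo_def
proof (intro conjI allI)
  have "isCont \<phi> a" if a: "a \<in> S" for a
  proof -
    obtain r Q where rQ: "r > 0" "cball a r \<subseteq> S" "\<And>n::nat. line_holo (Q n) (cball a r)"
      "uniform_limit (cball a r) Q \<phi> sequentially" using assms(2)[OF a] by blast
    have "continuous_on (cball a r) \<phi>"
      by (rule uniform_limit_theorem[OF _ rQ(4)]) (use line_holoD(1)[OF rQ(3)] in auto)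
    then show ?thesis
      using rQ(1) by (meson ball_subset_cball centre_in_ball continuous_on_eq_continuous_at continuous_on_subset open_ball)
  qed
  then show "continuous_on S \<phi>" by (simp add: continuous_at_imp_continuous_on)
next
  fix b v
  show "(\<lambda>t. \<phi> (b + t *s v)) holomorphic_on {t. b + t *s v \<in> S}"
  proof (rule holomorphic_onI)
    fix t assume "t \<in> {t. b + t *s v \<in> S}"
    then have tS: "b + t *s v \<in> S" by simp
    let ?a = "b + t *s v"
    obtain r Q where rQ: "r > 0" "cball ?a r \<subseteq> S" "\<And>n::nat. line_holo (Q n) (cball ?a r)"
      "uniform_limit (cball ?a r) Q \<phi> sequentially" using assms(2)[OF tS] by blast
    define T where "T = {t. b + t *s v \<in> ball ?a r}"
    have oT: "open T" unfolding T_def by (rule open_line) auto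
    have tT: "t \<in> T" using rQ(1) by (simp add: T_def)
    have "(\<lambda>t. \<phi> (b + t *s v)) holomorphic_on T"
    proof (rule holomorphic_uniform_sequence[OF oT])
      show "(\<lambda>t. Q n (b + t *s v)) holomorphic_on T" for n
        by (rule holomorphic_on_subset[OF line_holoD(2)[OF rQ(3)[of n]]]) (auto simp: T_def)
      fix x assume "x \<in> T"
      then obtain d where d: "d > 0" "cball x d \<subseteq> T" using oT open_contains_cball by blast
      moreover have "uniform_limit (cball x d) (\<lambda>n t. Q n (b + t *s v)) (\<lambda>t. \<phi> (b + t *s v)) sequentially"
        by (rule uniform_limit_compose'[OF rQ(4)]) (use d in \<open>force simp: T_def\<close>)
      ultimately show "\<exists>d>0. cball x d \<subseteq> T \<and>
        uniform_limit (cball x d) (\<lambda>n t. Q n (b + t *s v)) (\<lambda>t. \<phi> (b + t *s v)) sequentially" by blast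
    qed
    then show "(\<lambda>t. \<phi> (b + t *s v)) field_differentiable at t within {t. b + t *s v \<in> S}"
      using oT tT by (meson field_differentiable_at_within holomorphic_on_imp_differentiable_at)
  qed
qed

lemma line_holo_shift:
  assumes "line_holo \<phi> S" "\<And>z. z \<in> T \<Longrightarrow> z + c \<in> S"
  shows "line_holo (\<lambda>z. \<phi> (z + c)) T"
  unfolding line_holo_def
proof (intro conjI allI)
  show "continuous_on T (\<lambda>z. \<phi> (z + c))"
    by (rule continuous_on_compose2[OF line_holoD(1)[OF assms(1)]])
      (use assms in \<open>auto intro!: continuous_intros\<close>)
  fix a v
  have "(\<lambda>t. \<phi> ((a + c) + t *s v)) holomorphic_on {t. a + t *s v \<in> T}"
    by (rule holomorphic_on_subset[OF line_holoD(2)[OF assms(1)]])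
      (use assms(2) in \<open>force simp: algebra_simps\<close>)
  then show "(\<lambda>t. \<phi> (a + t *s v + c)) holomorphic_on {t. a + t *s v \<in> T}"
    by (simp add: algebra_simps)
qed

lemma line_holo_const: "line_holo (\<lambda>z. c) S"
  by (auto simp: line_holo_def)

lemma line_holo_diff: "line_holo f S \<Longrightarrow> line_holo g S \<Longrightarrow> line_holo (\<lambda>z. f z - g z) S"
  by (auto simp: line_holo_def intro!: continuous_intros holomorphic_intros)

lemma line_holo_mult: "line_holo f S \<Longrightarrow> line_holo g S \<Longrightarrow> line_holo (\<lambda>z. f z * g z) S"
  by (auto simp: line_holo_def intro!: continuous_intros holomorphic_intros)

lemma line_holo_sum: "(\<And>i. i \<in> I \<Longrightarrow> line_holo (f i) S) \<Longrightarrow> line_holo (\<lambda>z. \<Sum>i\<in>I. f i z) S"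
  by (auto simp: line_holo_def intro!: continuous_intros holomorphic_intros)

lemma line_holo_prod: "(\<And>i. i \<in> I \<Longrightarrow> line_holo (f i) S) \<Longrightarrow> line_holo (\<lambda>z. \<Prod>i\<in>I. f i z) S"
  by (auto simp: line_holo_def intro!: continuous_intros holomorphic_intros)

lemma line_holo_det:
  assumes "\<And>i j. line_holo (\<lambda>z. A z $ i $ j) S"
  shows "line_holo (\<lambda>z. det (A z)) S"
  unfolding det_def by (intro line_holo_sum line_holo_mult line_holo_prod line_holo_const assms)

text \<open>For a fixed step the difference quotient is line-holomorphic in its base point, and by
  \<open>diff_quotient_uniform_bound\<close> the quotients converge locally uniformly.\<close>

lemma line_holo_dirderiv:
  assumes "open S" "line_holo \<phi> S"
  shows "line_holo (dirderiv \<phi> u) S"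
proof (rule line_holo_uniform_limit[OF assms(1)])
  fix a assume "a \<in> S"
  then obtain r C \<delta> where r: "0 < r" "cball a r \<subseteq> S" "0 < \<delta>" "0 \<le> C"
    and inS: "\<And>z s. z \<in> cball a r \<Longrightarrow> cmod s \<le> \<delta> \<Longrightarrow> z + s *s u \<in> S"
    and est: "\<And>z s. z \<in> cball a r \<Longrightarrow> s \<noteq> 0 \<Longrightarrow> cmod s \<le> \<delta> \<Longrightarrow>
       cmod ((\<phi> (z + s *s u) - \<phi> z) / s - dirderiv \<phi> u z) \<le> C * cmod s"
    using diff_quotient_uniform_bound[OF assms] by metis
  \<comment> \<open>With the denominator \<open>n + 1\<close> all steps, including the one for
    \<open>n = 0\<close>, have modulus at most \<open>\<delta>\<close>.\<close>
  define s where "s n = complex_of_real (\<delta> / (real n + 1))" for n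
  have s: "s n \<noteq> 0" "cmod (s n) \<le> \<delta>" for n
    using r by (auto simp: s_def norm_divide field_simps simp del: of_real_add of_real_divide)
  define Q where "Q n z = (\<phi> (z + s n *s u) - \<phi> z) * (1 / s n)" for n z
  have "line_holo (Q n) (cball a r)" for n
    unfolding Q_def
    by (intro line_holo_mult line_holo_diff line_holo_shift[OF assms(2)] line_holo_const
          line_holo_subset[OF assms(2)] r(2) inS s)
  moreover have "uniform_limit (cball a r) Q (dirderiv \<phi> u) sequentially"
  proof (rule uniform_limitI)
    fix e :: real assume "e > 0"
    have "(\<lambda>n. C * (\<delta> / (real n + 1))) \<longlonglongrightarrow> C * 0"
      by (intro tendsto_mult_left real_tendsto_divide_at_top[OF tendsto_const]) real_asymp
    then have "\<forall>\<^sub>F n in sequentially. C * (\<delta> / (real n + 1)) < e"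
      using \<open>e > 0\<close> by (intro order_tendstoD(2)) auto
    then show "\<forall>\<^sub>F n in sequentially. \<forall>z\<in>cball a r. dist (Q n z) (dirderiv \<phi> u z) < e"
    proof eventually_elim
      case (elim n)
      have "cmod (s n) = \<delta> / (real n + 1)" using r by (simp add: s_def norm_divide del: of_real_add of_real_divide)
      then show ?case using est[of _ "s n"] s[of n] elim
        by (force simp: dist_norm Q_def)
    qed
  qed
  ultimately show "\<exists>r>0. \<exists>Q. cball a r \<subseteq> S \<and> (\<forall>n::nat. line_holo (Q n) (cball a r)) \<and>
            uniform_limit (cball a r) Q (dirderiv \<phi> u) sequentially"
    using r by blast
qed

section \<open>Complex linearity of the directional derivative\<close>

lemma scaleR_eq_smult: "r *\<^sub>R (v :: complex ^ 'n) = complex_of_real r *s v"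
  unfolding vec_eq_iff vector_scaleR_component vector_smult_component by (simp add: scaleR_conv_of_real)

lemma dirderiv_line_0:
  assumes "open S" "line_holo \<phi> S" "z \<in> S"
  shows "((\<lambda>t. \<phi> (z + t *s v)) has_field_derivative dirderiv \<phi> v z) (at 0)"
  using dirderiv_line[OF assms(1,2), of z 0 v] assms(3) by simp

lemma dirderiv_scale:
  assumes "open S" "line_holo \<phi> S" "z \<in> S"
  shows "dirderiv \<phi> (c *s v) z = c * dirderiv \<phi> v z"
proof -
  have "((\<lambda>t. \<phi> (z + (c * t) *s v)) has_field_derivative dirderiv \<phi> v z * c) (at 0)"
    by (rule DERIV_chain2[of "\<lambda>t. \<phi> (z + t *s v)"])
      (use dirderiv_line_0[OF assms] in \<open>auto intro!: derivative_eq_intros\<close>)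
  then show ?thesis
    unfolding dirderiv_def[of _ "c *s v"]
    by (intro DERIV_imp_deriv) (simp add: vector_smult_assoc mult.commute)
qed

text \<open>The increment along \<open>u + v\<close> splits into the increment along \<open>u\<close> at \<open>z\<close> and the one along
  \<open>v\<close> at the moving point \<open>z + s u\<close>; the uniform estimate on difference quotients and the
  continuity of \<open>dirderiv \<phi> v\<close> control the latter.\<close>

lemma dirderiv_add:
  assumes "open S" "line_holo \<phi> S" "z \<in> S"
  shows "dirderiv \<phi> (u + v) z = dirderiv \<phi> u z + dirderiv \<phi> v z"
proof -
  obtain r C \<delta> where r: "0 < r" "cball z r \<subseteq> S" "0 < \<delta>" "0 \<le> C"
    and est: "\<And>y s. y \<in> cball z r \<Longrightarrow> s \<noteq> 0 \<Longrightarrow> cmod s \<le> \<delta> \<Longrightarrow>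
       cmod ((\<phi> (y + s *s v) - \<phi> y) / s - dirderiv \<phi> v y) \<le> C * cmod s"
    using diff_quotient_uniform_bound[OF assms] by metis
  have lim: "((\<lambda>s. (\<phi> (z + s *s w) - \<phi> z) / s) \<longlongrightarrow> dirderiv \<phi> w z) (at 0)" for w
    using dirderiv_line_0[OF assms, of w] by (simp add: DERIV_def)
  have path: "((\<lambda>s. z + s *s u) \<longlongrightarrow> z) (at 0)"
  proof -
    have "isCont (\<lambda>s. z + s *s u) 0"
      using continuous_on_eq_continuous_at[of UNIV "\<lambda>s. z + s *s u"] by (simp add: continuous_intros)
    then show ?thesis by (simp add: isCont_def)
  qed
  have "isCont (dirderiv \<phi> v) z"
    using line_holoD(1)[OF line_holo_dirderiv[OF assms(1,2)]] assms(1,3)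
    by (simp add: continuous_on_eq_continuous_at)
  then have l1: "((\<lambda>s. dirderiv \<phi> v (z + s *s u)) \<longlongrightarrow> dirderiv \<phi> v z) (at 0)"
    using path by (rule isCont_tendsto_compose)
  have "((\<lambda>s. (\<phi> ((z + s *s u) + s *s v) - \<phi> (z + s *s u)) / s - dirderiv \<phi> v (z + s *s u)) \<longlongrightarrow> 0) (at 0)"
  proof (rule Lim_null_comparison)
    have "\<forall>\<^sub>F s in at 0. dist (z + s *s u) z < r"
      using path r(1) by (rule tendstoD)
    moreover have "\<forall>\<^sub>F s in at (0::complex). s \<noteq> 0 \<and> cmod s \<le> \<delta>"
      unfolding eventually_at by (rule exI[of _ \<delta>]) (use r(3) in auto)
    ultimately show "\<forall>\<^sub>F s in at 0. cmod ((\<phi> ((z + s *s u) + s *s v) - \<phi> (z + s *s u)) / s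
        - dirderiv \<phi> v (z + s *s u)) \<le> C * cmod s"
      by eventually_elim (use est in \<open>auto simp: dist_commute\<close>)
    show "((\<lambda>s. C * cmod s) \<longlongrightarrow> 0) (at 0)"
      by (auto intro!: tendsto_eq_intros)
  qed
  from tendsto_add[OF lim[of u] tendsto_add[OF this l1]]
  have "((\<lambda>s. (\<phi> (z + s *s (u + v)) - \<phi> z) / s) \<longlongrightarrow> dirderiv \<phi> u z + dirderiv \<phi> v z) (at 0)"
    by (simp add: vector_add_ldistrib add.assoc diff_divide_distrib)
  with lim[of "u + v"] show ?thesis
    by (rule tendsto_unique[rotated]) simp
qed

lemma dirderiv_expansion:
  assumes "open S" "line_holo \<phi> S" "z \<in> S"
  shows "dirderiv \<phi> v z = (\<Sum>j\<in>UNIV. v $ j * dirderiv \<phi> (axis j 1) z)"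
proof -
  have "dirderiv \<phi> (\<Sum>j\<in>J. v $ j *s axis j 1) z = (\<Sum>j\<in>J. v $ j * dirderiv \<phi> (axis j 1) z)"
    if "finite J" for J
    using that
  proof induction
    case empty
    \<comment> \<open>The empty sum is the zero vector, read as 0 times itself so that homogeneity
      makes the derivative vanish.\<close>
    show ?case using dirderiv_scale[OF assms, of 0 0] by simp
  next
    case (insert j J)
    then show ?case by (simp add: dirderiv_add[OF assms] dirderiv_scale[OF assms])
  qed
  from this[of UNIV] show ?thesis by (simp add: basis_expansion)
qed

section \<open>Line-holomorphy and complex Frechet differentiability\<close>

text \<open>The Taylor estimate has the same constant for all unit directions, which turns the
  directional derivatives into a Frechet derivative with quadratic remainder.\<close>

lemma line_holo_has_derivative:
  assumes "open S" "line_holo \<phi> S" "z \<in> S"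
  shows "(\<phi> has_derivative (\<lambda>h. dirderiv \<phi> h z)) (at z)"
proof -
  obtain R where R: "0 < R" "cball z R \<subseteq> S"
    using assms open_contains_cball by blast
  obtain M where M: "\<And>y. y \<in> cball z R \<Longrightarrow> cmod (\<phi> y) \<le> M"
    using continuous_on_compact_norm_bound[OF continuous_on_subset[OF line_holoD(1)[OF assms(2)] R(2)] compact_cball]
    by metis
  show ?thesis
  proof (rule has_derivativeI_sandwich[of "R/2"])
    have "linear (\<lambda>h. dirderiv \<phi> h z)"
    proof (rule linearI)
      fix r and h
      show "dirderiv \<phi> (r *\<^sub>R h) z = r *\<^sub>R dirderiv \<phi> h z"
        unfolding scaleR_eq_smult dirderiv_scale[OF assms] by (simp add: scaleR_conv_of_real)
    qed (rule dirderiv_add[OF assms])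
    then show "bounded_linear (\<lambda>h. dirderiv \<phi> h z)"
      by (simp add: linear_conv_bounded_linear)
    show "0 < R/2" using R(1) by simp
    show "((\<lambda>y. 8 * M / R\<^sup>2 * norm (y - z)) \<longlongrightarrow> 0) (at z)"
      using R(1) by (auto intro!: tendsto_eq_intros)
    fix y assume y: "y \<in> UNIV" "y \<noteq> z" "dist y z < R/2"
    \<comment> \<open>The increment is split into its length \<open>s\<close>, embedded in the
      complex scalars to fit line sections, and its unit direction \<open>u\<close>.\<close>
    define s where "s = complex_of_real (norm (y - z))"
    define u where "u = (1 / s) *s (y - z)"
    have s: "s \<noteq> 0" "cmod s = norm (y - z)" using y by (auto simp: s_def)
    have u: "norm u = 1" "y = z + s *s u"
      unfolding u_def norm_vector_smult vector_smult_assoc using s y by (simp_all add: norm_divide)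
    have "cmod ((\<phi> (z + s *s u) - \<phi> (z + 0 *s u)) / s - deriv (\<lambda>t. \<phi> (z + t *s u)) 0) \<le> 8 * M / R\<^sup>2 * cmod s"
    proof (rule cmod_diff_quotient_le[where \<psi>="\<lambda>t. \<phi> (z + t *s u)"])
      show "open {t. z + t *s u \<in> S}" by (rule open_line[OF assms(1)])
      show "(\<lambda>s. \<phi> (z + s *s u)) holomorphic_on {t. z + t *s u \<in> S}" by (rule line_holoD(2)[OF assms(2)])
      have "z + t *s u \<in> cball z R" if "t \<in> cball 0 R" for t
        using that u by (simp add: dist_norm norm_vector_smult)
      then show "cball 0 R \<subseteq> {t. z + t *s u \<in> S}" "\<And>t. t \<in> cball 0 R \<Longrightarrow> cmod (\<phi> (z + t *s u)) \<le> M"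
        using R M by auto
    qed (use R s y in \<open>simp_all add: dist_norm\<close>)
    moreover have "deriv (\<lambda>t. \<phi> (z + t *s u)) 0 = dirderiv \<phi> (y - z) z / s"
      using dirderiv_scale[OF assms, of "1/s" "y - z"] by (simp add: u_def dirderiv_def)
    moreover have "(\<phi> y - \<phi> z) / s - dirderiv \<phi> (y - z) z / s = (\<phi> y - \<phi> z - dirderiv \<phi> (y - z) z) / s"
      by (simp add: diff_divide_distrib)
    ultimately show "cmod (\<phi> y - \<phi> z - dirderiv \<phi> (y - z) z) / norm (y - z) \<le> 8 * M / R\<^sup>2 * norm (y - z)"
      using u s by (simp add: norm_divide)
  qed
qed

lemma bounded_linear_smult_left: "bounded_linear (\<lambda>c. c *s (v :: complex ^ 'n))"
  unfolding linear_conv_bounded_linear[symmetric]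
  by (rule linearI) (simp_all add: vector_sadd_rdistrib scaleR_eq_smult vector_smult_assoc scaleR_conv_of_real)

lemma complex_jacobian_has_derivative:
  fixes F :: "complex ^ 'n \<Rightarrow> complex ^ 'm"
  assumes "open S" "\<And>i. line_holo (\<lambda>w. F w $ i) S" "z \<in> S"
  shows "(F has_derivative (*v) (complex_jacobian F z)) (at z)"
proof -
  have "((\<lambda>w. \<Sum>i\<in>UNIV. (F w $ i) *s axis i 1) has_derivative
      (\<lambda>h. \<Sum>i\<in>UNIV. dirderiv (\<lambda>w. F w $ i) h z *s axis i 1)) (at z)"
    by (intro has_derivative_sum bounded_linear.has_derivative[OF bounded_linear_smult_left]
        line_holo_has_derivative[OF assms(1) assms(2) assms(3)])
  moreover have "(\<Sum>i\<in>UNIV. dirderiv (\<lambda>w. F w $ i) h z *s axis i 1) = complex_jacobian F z *v h" for h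
  proof -
    have "(\<Sum>i\<in>UNIV. ((complex_jacobian F z *v h) $ i) *s axis i 1) = complex_jacobian F z *v h"
      by (rule basis_expansion)
    then show ?thesis
      by (simp add: complex_jacobian_def matrix_vector_mult_def dirderiv_expansion[OF assms(1,2,3), of _ h] mult.commute)
  qed
  ultimately show ?thesis by (simp add: basis_expansion)
qed

text \<open>On a line the chain rule gives the derivative \<open>f' (t *s v)\<close>, which complex
  homogeneity turns into multiplication by the number \<open>f' v\<close>.\<close>

lemma line_holoI:
  assumes "open S"
    and "\<And>z. z \<in> S \<Longrightarrow> \<exists>f'. (\<phi> has_derivative f') (at z) \<and> (\<forall>c h. f' (c *s h) = c * f' h)"
  shows "line_holo \<phi> S"
  unfolding line_holo_def
proof (intro conjI allI)
  show "continuous_on S \<phi>"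
    using assms(2) has_derivative_continuous by (blast intro: continuous_at_imp_continuous_on)
  fix a v
  show "(\<lambda>t. \<phi> (a + t *s v)) holomorphic_on {t. a + t *s v \<in> S}"
  proof (rule holomorphic_onI)
    fix t assume "t \<in> {t. a + t *s v \<in> S}"
    then obtain f' where f': "(\<phi> has_derivative f') (at (a + t *s v))" "\<And>c h. f' (c *s h) = c * f' h"
      using assms(2) by blast
    have "((\<lambda>t. a + t *s v) has_derivative (\<lambda>t. t *s v)) (at t)"
      by (auto intro!: derivative_eq_intros bounded_linear.has_derivative[OF bounded_linear_smult_left])
    then have "((\<lambda>t. \<phi> (a + t *s v)) has_derivative (\<lambda>t. f' (t *s v))) (at t)"
      by (rule has_derivative_compose[where f="\<lambda>t. a + t *s v"]) (rule f'(1))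
    then have "((\<lambda>t. \<phi> (a + t *s v)) has_field_derivative f' v) (at t)"
      by (simp add: f'(2) has_field_derivative_def mult_commute_abs)
    then show "(\<lambda>t. \<phi> (a + t *s v)) field_differentiable at t within {t. a + t *s v \<in> S}"
      using field_differentiable_at_within field_differentiable_def by blast
  qed
qed

lemma line_holo_component:
  assumes "open S"
    and "\<And>z. z \<in> S \<Longrightarrow> \<exists>f'. (F has_derivative f') (at z) \<and> Vector_Spaces.linear (*s) (*s) f'"
  shows "line_holo (\<lambda>w. F w $ i) S"
proof (rule line_holoI[OF assms(1)])
  fix z assume "z \<in> S"
  then obtain f' where f': "(F has_derivative f') (at z)" "Vector_Spaces.linear (*s) (*s) f'"
    using assms(2) by blast
  then interpret Vector_Spaces.linear "(*s)" "(*s)" f' by simp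
  show "\<exists>f'. ((\<lambda>w. F w $ i) has_derivative f') (at z) \<and> (\<forall>c h. f' (c *s h) = c * f' h)"
    by (rule exI[of _ "\<lambda>h. f' h $ i"])
      (auto simp: scale intro!: bounded_linear.has_derivative[OF bounded_linear_vec_nth] f'(1))
qed

lemma holomorphic_map_on_line_holo:
  assumes "open S" "holomorphic_map_on F S"
  shows "line_holo (\<lambda>w. F w $ i) S"
proof (rule line_holo_component[OF assms(1)])
  fix z assume "z \<in> S"
  with assms(2) show "\<exists>f'. (F has_derivative f') (at z) \<and> Vector_Spaces.linear (*s) (*s) f'"
    unfolding holomorphic_map_on_def by (metis at_within_open assms(1))
qed

lemma line_holo_continuous_on:
  assumes "\<And>i. line_holo (\<lambda>w. F w $ i) S"
  shows "continuous_on S (F :: complex ^ 'n \<Rightarrow> complex ^ 'm)"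
proof -
  have "continuous_on S (\<lambda>w. \<chi> i. F w $ i)"
    by (intro continuous_on_vec_lambda line_holoD(1) assms)
  then show ?thesis by simp
qed

lemma line_holo_det_jacobian:
  fixes F :: "complex ^ 'n \<Rightarrow> complex ^ 'n"
  assumes "open S" "\<And>i. line_holo (\<lambda>w. F w $ i) S"
  shows "line_holo (\<lambda>z. det (complex_jacobian F z)) S"
proof (rule line_holo_det)
  show "line_holo (\<lambda>z. complex_jacobian F z $ i $ j) S" for i j
    using line_holo_dirderiv[OF assms(1) assms(2)[of i]] by (simp add: complex_jacobian_def)
qed

lemma complex_jacobian_unique:
  assumes "open S" "\<And>i. line_holo (\<lambda>w. F w $ i) S" "z \<in> S" "(F has_derivative (*v) A) (at z)"
  shows "complex_jacobian F z = A"
  using arg_cong[OF has_derivative_unique[OF complex_jacobian_has_derivative[OF assms(1-3)] assms(4)], of matrix]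
  by simp

subsection \<open>Nonvanishing of the Jacobian of an injective holomorphic map\<close>

text \<open>The frontier of the region where \<open>H\<close> is nonzero consists of points of the
  circle, where \<open>K\<close> bounds \<open>\<phi>\<close>, and zeros of \<open>H\<close>, where
  the product \<open>\<phi> t ^ n * H t\<close> vanishes. With \<open>B\<close> a bound for
  \<open>H\<close>, this gives \<open>cmod (\<phi> 0) ^ n * cmod (H 0) \<le> K ^ n * B\<close> for
  all \<open>n\<close>, and large \<open>n\<close> eliminates \<open>B\<close> and
  \<open>H 0\<close>.\<close>

lemma norm_le_off_zeros:
  assumes "0 < R" "0 < K" "continuous_on (cball 0 R) \<phi>" "continuous_on (cball 0 R) H"
    and "\<phi> holomorphic_on {t \<in> ball 0 R. H t \<noteq> 0}" "H holomorphic_on {t \<in> ball 0 R. H t \<noteq> 0}"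
    and K: "\<And>t. cmod t = R \<Longrightarrow> cmod (\<phi> t) \<le> K" and "H 0 \<noteq> 0"
  shows "cmod (\<phi> 0) \<le> K"
proof (rule ccontr)
  assume "\<not> cmod (\<phi> 0) \<le> K"
  then have gt: "cmod (\<phi> 0) / K > 1" using assms(2) by simp
  define \<Omega> where "\<Omega> = {t \<in> ball 0 R. H t \<noteq> 0}"
  have sub: "\<Omega> \<subseteq> cball 0 R" by (auto simp: \<Omega>_def)
  have op: "open \<Omega>"
  proof -
    have "continuous_on (ball 0 R) H" using assms(4) by (rule continuous_on_subset) auto
    then have "open (ball 0 R \<inter> H -` (-{0}))" by (rule continuous_open_preimage) auto
    moreover have "ball 0 R \<inter> H -` (-{0}) = \<Omega>" by (auto simp: \<Omega>_def)
    ultimately show ?thesis by simp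
  qed
  have clo: "closure \<Omega> \<subseteq> cball 0 R" using sub by (simp add: closure_minimal)
  obtain B where B: "0 < B" "\<And>t. t \<in> cball 0 R \<Longrightarrow> cmod (H t) \<le> B"
    using continuous_on_compact_norm_bound[OF assms(4) compact_cball] by metis
  have le: "cmod (\<phi> 0) ^ n * cmod (H 0) \<le> K ^ n * B" for n
  proof -
    have "cmod (\<phi> 0 ^ n * H 0) \<le> K ^ n * B"
    proof (rule maximum_modulus_frontier[of "\<lambda>t. \<phi> t ^ n * H t" \<Omega>])
      show "(\<lambda>t. \<phi> t ^ n * H t) holomorphic_on interior \<Omega>"
        using assms(5,6) op by (auto simp: interior_open \<Omega>_def intro!: holomorphic_intros)
      show "continuous_on (closure \<Omega>) (\<lambda>t. \<phi> t ^ n * H t)"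
        by (intro continuous_intros continuous_on_subset[OF assms(3) clo] continuous_on_subset[OF assms(4) clo])
      show "bounded \<Omega>" using sub bounded_subset bounded_cball by blast
      show "0 \<in> \<Omega>" using assms by (simp add: \<Omega>_def)
      fix t assume t: "t \<in> frontier \<Omega>"
      then have tR: "t \<in> cball 0 R" and nt: "t \<notin> \<Omega>"
        using clo op by (auto simp: frontier_def interior_open)
      show "cmod (\<phi> t ^ n * H t) \<le> K ^ n * B"
      proof (cases "cmod t = R")
        case True
        then show ?thesis
          using K[OF True] B(2)[OF tR] assms(2)
          by (simp add: norm_mult norm_power mult_mono power_mono)
      next
        case False
        \<comment> \<open>The point lies in the open disc but outside
          \<open>\<Omega>\<close>.\<close>
        with tR nt have "H t = 0" by (auto simp: \<Omega>_def)
        then show ?thesis using assms(2) B(1) by simp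
      qed
    qed
    then show ?thesis by (simp add: norm_mult norm_power)
  qed
  \<comment> \<open>Powers of a ratio above 1 eventually exceed the fixed quotient
    \<open>B / cmod (H 0)\<close>.\<close>
  obtain n where n: "B / cmod (H 0) < (cmod (\<phi> 0) / K) ^ n"
    using real_arch_pow[OF gt] by blast
  have pos: "0 < cmod (H 0)" "0 < K ^ n" using assms(2,8) by simp_all
  from n have "B / cmod (H 0) < cmod (\<phi> 0) ^ n / K ^ n"
    by (simp only: power_divide)
  then have "K ^ n * B < cmod (\<phi> 0) ^ n * cmod (H 0)"
    using pos by (simp only: divide_less_eq less_divide_eq times_divide_eq_left if_True) (simp add: ac_simps)
  with le[of n] show False by simp
qed

text \<open>Each of the n! terms of Leibniz's formula is a product of n entries up to sign.\<close>

lemma norm_det_le: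
  fixes A :: "complex ^ 'n ^ 'n"
  assumes "\<And>i j. cmod (A $ i $ j) \<le> K"
  shows "cmod (det A) \<le> fact CARD('n) * K ^ CARD('n)"
proof -
  have "cmod (of_int (sign p) * (\<Prod>i\<in>UNIV. A $ i $ p i)) \<le> K ^ CARD('n)" for p
  proof -
    have "(\<Prod>i\<in>UNIV. cmod (A $ i $ p i)) \<le> (\<Prod>i\<in>(UNIV::'n set). K)"
      by (rule prod_mono) (simp add: assms)
    moreover have "cmod (of_int (sign p)) = 1"
      by (simp add: sign_def)
    ultimately show ?thesis by (simp add: norm_mult prod_norm)
  qed
  then have "cmod (det A) \<le> of_nat (card {p. p permutes (UNIV::'n set)}) * K ^ CARD('n)"
    unfolding det_def by (intro sum_norm_bound) simp
  also have "card {p. p permutes (UNIV::'n set)} = fact CARD('n)"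
    by (rule card_permutations) auto
  finally show ?thesis by simp
qed

section \<open>The inverse of an injective holomorphic map at regular values\<close>

text \<open>Invariance of domain makes the image open and the inverse continuous on all of it, and a
  continuous inverse is differentiable wherever the derivative of \<open>F\<close> is invertible. At
  critical values continuity is all that is shown, which suffices for
  \<open>norm_le_off_zeros\<close>.\<close>

lemma
  fixes F :: "complex ^ 'n \<Rightarrow> complex ^ 'n"
  assumes D: "open D" "\<And>i. line_holo (\<lambda>w. F w $ i) D" "inj_on F D"
  defines "g \<equiv> inv_into D F"
  defines "W \<equiv> {w \<in> F ` D. det (complex_jacobian F (g w)) \<noteq> 0}"
  shows open_injective_image: "open (F ` D)"
    and continuous_on_inv_injective: "continuous_on (F ` D) g"
    and continuous_on_det_jacobian_inv: "continuous_on (F ` D) (\<lambda>w. det (complex_jacobian F (g w)))"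
    and open_regular_values: "open W"
    and line_holo_inv_injective: "line_holo (\<lambda>w. g w $ i) W"
    and det_jacobian_inv: "w \<in> W \<Longrightarrow> det (complex_jacobian g w) * det (complex_jacobian F (g w)) = 1"
proof -
  have cF: "continuous_on D F" by (rule line_holo_continuous_on[OF D(2)])
  show oV: "open (F ` D)" by (rule invariance_of_domain[OF cF D(1,3)])
  have gF: "g (F z) = z" if "z \<in> D" for z using that D(3) by (simp add: g_def)
  show cg: "continuous_on (F ` D) g"
    by (rule continuous_on_inverse_open[OF D(1) cF _ gF]) auto
  have Fg: "F (g w) = w" "g w \<in> D" if "w \<in> F ` D" for w
    using that by (auto simp: g_def f_inv_into_f inv_into_into)
  show cd: "continuous_on (F ` D) (\<lambda>w. det (complex_jacobian F (g w)))"
    by (rule continuous_on_compose2[OF line_holoD(1)[OF line_holo_det_jacobian[OF D(1,2)]] cg])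
      (use Fg in auto)
  have "W = F ` D \<inter> (\<lambda>w. det (complex_jacobian F (g w))) -` (- {0})" by (auto simp: W_def)
  then show oW: "open W"
    using continuous_open_preimage[OF cd oV, of "- {0}"] by (simp add: open_Compl)
  \<comment> \<open>The derivative of \<open>g\<close> is the inverse matrix \<open>B\<close>; being
    a complex matrix it acts complex-linearly, which makes \<open>g\<close> line-holomorphic on
    \<open>W\<close>.\<close>
  have der: "\<exists>B. (g has_derivative (*v) B) (at w) \<and> B ** complex_jacobian F (g w) = mat 1" if "w \<in> W" for w
  proof -
    have w: "w \<in> F ` D" "det (complex_jacobian F (g w)) \<noteq> 0" using that by (auto simp: W_def)
    then obtain B where B: "B ** complex_jacobian F (g w) = mat 1"
      using invertible_det_nz[of "complex_jacobian F (g w)"] by (auto simp: invertible_def)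
    have "(g has_derivative (*v) B) (at w)"
    proof (rule has_derivative_inverse_basic[OF complex_jacobian_has_derivative[OF D(1,2)]])
      show "g w \<in> D" by (rule Fg[OF w(1)])
      show "bounded_linear ((*v) B)" by simp
      show "(*v) B \<circ> (*v) (complex_jacobian F (g w)) = id"
        by (auto simp: fun_eq_iff matrix_vector_mul_assoc B)
      show "continuous (at w) g" using cg oV w(1) continuous_on_eq_continuous_at by blast
    qed (use oV w Fg in auto)
    with B show ?thesis by blast
  qed
  show lg: "line_holo (\<lambda>w. g w $ i) W" for i
    by (rule line_holo_component[OF oW]) (use der matrix_vector_mul_linear_gen in blast)
  show "det (complex_jacobian g w) * det (complex_jacobian F (g w)) = 1" if wW: "w \<in> W"
  proof -
    obtain B where B: "(g has_derivative (*v) B) (at w)" "B ** complex_jacobian F (g w) = mat 1"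
      using der[OF wW] by blast
    have "complex_jacobian g w = B" by (rule complex_jacobian_unique[OF oW lg wW B(1)])
    then show ?thesis using B(2) det_mul[of B "complex_jacobian F (g w)"] by simp
  qed
qed

text \<open>Coordinate lines through \<open>F z\<close> may meet critical values, where the inverse
  is only known to be continuous, so \<open>norm_le_off_zeros\<close> replaces Cauchy's inequality
  in bounding the entries of its Jacobian by \<open>2 * M / R\<close>. The determinants of the two
  Jacobians are reciprocal, so this bounds that of \<open>F\<close> from below.\<close>

lemma det_jacobian_lower_bound:
  fixes F :: "complex ^ 'n \<Rightarrow> complex ^ 'n"
  assumes D: "open D" "\<And>i. line_holo (\<lambda>w. F w $ i) D" "inj_on F D"
    and "D \<subseteq> cball 0 M" "0 < M" "0 < R" "cball (F z) R \<subseteq> F ` D" "z \<in> D" "det (complex_jacobian F z) \<noteq> 0"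
  shows "1 \<le> fact CARD('n) * (2 * M / R) ^ CARD('n) * cmod (det (complex_jacobian F z))"
proof -
  define g where "g = inv_into D F"
  define W where "W = {w \<in> F ` D. det (complex_jacobian F (g w)) \<noteq> 0}"
  note inv = open_injective_image[OF D] continuous_on_inv_injective[OF D, folded g_def]
    continuous_on_det_jacobian_inv[OF D, folded g_def]
    open_regular_values[OF D, folded g_def, folded W_def]
    line_holo_inv_injective[OF D, folded g_def, folded W_def]
    det_jacobian_inv[OF D, folded g_def, folded W_def]
  define w where "w = F z"
  have gw: "g w = z" using assms(8) D(3) by (simp add: g_def w_def)
  have wW: "w \<in> W" using assms(8,9) gw by (auto simp: W_def w_def)
  have gM: "norm (g y) \<le> M" if "y \<in> F ` D" for y
    using that assms(4) inv_into_into[of y F D] by (auto simp: g_def)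
  have entry: "cmod (complex_jacobian g w $ i $ j) \<le> 2 * M / R" for i j
  proof -
    let ?l = "\<lambda>t. w + t *s axis j 1"
    define G where "G t = g (?l t) $ i" for t
    define H where "H t = det (complex_jacobian F (g (?l t)))" for t
    \<comment> \<open>The difference quotient of \<open>G\<close> at 0 with its removable
      singularity filled in; \<open>\<phi> 0\<close> is the Jacobian entry to be bounded.\<close>
    define \<phi> where "\<phi> t = (if t = 0 then deriv G 0 else (G t - G 0) / (t - 0))" for t
    define T where "T = {t. ?l t \<in> W}"
    have oT: "open T" unfolding T_def by (rule open_line[OF inv(4)])
    have l_in: "?l t \<in> F ` D" if "t \<in> cball 0 R" for t
      using assms(7) that by (auto simp: w_def dist_norm norm_vector_smult norm_axis_complex subset_iff)
    have cl: "continuous_on (cball 0 R) ?l" by (intro continuous_intros)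
    have cG: "continuous_on (cball 0 R) G" unfolding G_def
      by (intro continuous_intros continuous_on_compose2[OF inv(2) cl]) (use l_in in auto)
    have hG: "G holomorphic_on T" unfolding G_def T_def
      by (rule line_holoD(2)[OF inv(5)])
    have h\<phi>: "\<phi> holomorphic_on T" unfolding \<phi>_def
      by (rule pole_lemma_open[OF hG oT])
    have sub: "{t \<in> ball 0 R. H t \<noteq> 0} \<subseteq> T"
      using l_in by (auto simp: T_def W_def H_def)
    have "cmod (\<phi> 0) \<le> 2 * M / R"
    proof (rule norm_le_off_zeros)
      show "continuous_on (cball 0 R) H" unfolding H_def
        by (rule continuous_on_compose2[OF inv(3) cl]) (use l_in in auto)
      show "\<phi> holomorphic_on {t \<in> ball 0 R. H t \<noteq> 0}"
        by (rule holomorphic_on_subset[OF h\<phi> sub])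
      \<comment> \<open>On \<open>T\<close> the function \<open>H\<close> is the reciprocal of the
        Jacobian determinant of \<open>g\<close>, so its holomorphy follows without differentiating
        a composite.\<close>
      have "(\<lambda>t. det (complex_jacobian g (?l t))) holomorphic_on T"
        unfolding T_def by (rule line_holoD(2)[OF line_holo_det_jacobian[OF inv(4,5)]])
      then have "(\<lambda>t. inverse (det (complex_jacobian g (?l t)))) holomorphic_on T"
        by (rule holomorphic_on_inverse) (use inv(6) in \<open>force simp: T_def\<close>)
      moreover have "inverse (det (complex_jacobian g (?l t))) = H t" if "t \<in> T" for t
        using inv(6)[of "?l t"] that by (auto simp: T_def H_def intro: inverse_unique)
      ultimately have "H holomorphic_on T"
        by (rule holomorphic_transform)
      then show "H holomorphic_on {t \<in> ball 0 R. H t \<noteq> 0}"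
        using sub holomorphic_on_subset by blast
      show "H 0 \<noteq> 0" using assms(9) by (simp add: H_def gw)
      \<comment> \<open>At 0 this comes from holomorphy, \<open>w\<close> being a regular value;
        elsewhere \<open>\<phi>\<close> is a quotient of continuous functions, also over critical
        values.\<close>
      show "continuous_on (cball 0 R) \<phi>"
        unfolding continuous_on_eq_continuous_within
      proof
        fix t :: complex assume t: "t \<in> cball 0 R"
        show "continuous (at t within cball 0 R) \<phi>"
        proof (cases "t = 0")
          case True
          have "0 \<in> T" using wW by (simp add: T_def)
          then have "isCont \<phi> 0"
            using h\<phi> oT holomorphic_on_imp_continuous_on continuous_on_eq_continuous_at by blast
          then show ?thesis using True continuous_at_imp_continuous_at_within by blast
        next
          case False
          have "continuous (at t within cball 0 R) (\<lambda>t. (G t - G 0) / (t - 0))"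
            using cG t False
            by (auto simp: continuous_on_eq_continuous_within intro!: continuous_intros)
          then show ?thesis
            by (rule continuous_transform_within[where \<delta>="cmod t"])
              (use False t in \<open>auto simp: \<phi>_def\<close>)
        qed
      qed
      fix t :: complex assume t: "cmod t = R"
      have GM: "cmod (G s) \<le> M" if "s \<in> cball 0 R" for s
        using order_trans[OF Finite_Cartesian_Product.norm_nth_le gM[OF l_in[OF that]]] by (simp add: G_def)
      have "cmod (G t - G 0) \<le> 2 * M"
        using norm_triangle_ineq4[of "G t" "G 0"] GM[of t] GM[of 0] t assms(6) by simp
      then show "cmod (\<phi> t) \<le> 2 * M / R"
        using t assms(6) by (auto simp: \<phi>_def norm_divide divide_right_mono)
    qed (use assms in auto)
    then show ?thesis by (simp add: \<phi>_def complex_jacobian_def dirderiv_def G_def[abs_def])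
  qed
  have "1 = cmod (det (complex_jacobian g w)) * cmod (det (complex_jacobian F z))"
    using inv(6)[OF wW] by (metis gw norm_mult norm_one)
  also have "\<dots> \<le> fact CARD('n) * (2 * M / R) ^ CARD('n) * cmod (det (complex_jacobian F z))"
    by (intro mult_right_mono norm_det_le entry) auto
  finally show ?thesis .
qed

section \<open>Emptiness of the critical set\<close>

lemma noninj_of_det_eq_0:
  fixes A :: "complex ^ 'n ^ 'n"
  assumes "det A = 0"
  shows "\<not> inj ((*v) A)"
  using assms invertible_det_nz[of A] matrix_left_invertible_injective[of A]
  by (auto simp: invertible_left_inverse)

text \<open>A vanishing complex determinant makes the underlying real derivative noninjective. If
  this happened everywhere, Sard's theorem would make the image negligible, although it is open and
  nonempty.\<close>

lemma injective_imp_det_jacobian_nonzero_somewhere: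
  fixes F :: "complex ^ 'n \<Rightarrow> complex ^ 'n"
  assumes D: "open D" "\<And>i. line_holo (\<lambda>w. F w $ i) D" "inj_on F D" and "D \<noteq> {}"
  shows "\<exists>z\<in>D. det (complex_jacobian F z) \<noteq> 0"
proof (rule ccontr)
  assume "\<not> ?thesis"
  then have d0: "det (complex_jacobian F z) = 0" if "z \<in> D" for z using that by blast
  \<comment> \<open>The index type \<open>'n bit0\<close> has twice as many elements as \<open>'n\<close> and carries the well-order that
    the library's version of Sard's theorem demands.\<close>
  have "DIM(complex ^ 'n) = DIM(real ^ 'n bit0)" by simp
  then obtain p :: "complex ^ 'n \<Rightarrow> real ^ 'n bit0" and q where
    pq: "linear p" "linear q" "\<And>x. q (p x) = x" "\<And>y. p (q y) = y"
    using isomorphisms_UNIV_UNIV by metis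
  have bp: "bounded_linear p" "bounded_linear q"
    using pq(1,2) by (simp_all add: linear_conv_bounded_linear)
  \<comment> \<open>Conjugation by the real-linear isomorphisms \<open>p\<close> and
    \<open>q\<close> carries \<open>F\<close> to a real coordinate space; the derivative stays
    noninjective, so its rank drops.\<close>
  have "negligible ((\<lambda>x. p (F (q x))) ` (q -` D))"
  proof (rule baby_Sard[where f'="\<lambda>x h. p (complex_jacobian F (q x) *v q h)"])
    fix x assume "x \<in> q -` D"
    then have x: "q x \<in> D" by simp
    have "((\<lambda>x. p (F (q x))) has_derivative (\<lambda>h. p (complex_jacobian F (q x) *v q h))) (at x)"
      by (intro bounded_linear.has_derivative[OF bp(1)]
          has_derivative_compose[OF bounded_linear_imp_has_derivative[OF bp(2)]]
          complex_jacobian_has_derivative[OF D(1,2) x])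
    then show "((\<lambda>x. p (F (q x))) has_derivative (\<lambda>h. p (complex_jacobian F (q x) *v q h))) (at x within q -` D)"
      by (rule has_derivative_at_withinI)
    then have "linear (\<lambda>h. p (complex_jacobian F (q x) *v q h))"
      by (rule has_derivative_linear)
    moreover have "\<not> inj (\<lambda>h. p (complex_jacobian F (q x) *v q h))"
    proof
      assume i: "inj (\<lambda>h. p (complex_jacobian F (q x) *v q h))"
      have "inj ((*v) (complex_jacobian F (q x)))"
      proof (rule injI)
        fix a b assume "complex_jacobian F (q x) *v a = complex_jacobian F (q x) *v b"
        then have "p a = p b" using injD[OF i, of "p a" "p b"] by (simp add: pq)
        then show "a = b" by (metis pq(3))
      qed
      with noninj_of_det_eq_0[OF d0[OF x]] show False by simp
    qed
    ultimately show "rank (matrix (\<lambda>h. p (complex_jacobian F (q x) *v q h))) < CARD('n bit0)"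
      unfolding less_rank_noninjective by (simp only: matrix_vector_mul not_False_eq_True)
  qed simp
  moreover have "(\<lambda>x. p (F (q x))) ` (q -` D) = q -` (F ` D)"
  proof (intro equalityI subsetI)
    fix y assume "y \<in> q -` (F ` D)"
    then obtain z where z: "z \<in> D" "q y = F z" by auto
    then have "y = p (F (q (p z)))" by (metis pq(3,4))
    with z show "y \<in> (\<lambda>x. p (F (q x))) ` (q -` D)" using pq(3) by (metis image_eqI vimageI)
  qed (auto simp: pq)
  moreover have "open (q -` (F ` D))"
    by (intro open_vimage open_injective_image[OF D] linear_continuous_on bp(2))
  ultimately have "q -` (F ` D) = {}"
    using open_not_negligible by metis
  then show False using assms(4) pq(3) by (metis empty_iff image_eqI vimageI all_not_in_conv)
qed

text \<open>Near a zero of the determinant, \<open>det_jacobian_lower_bound\<close> would hold with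
  one constant at all noncritical points, while continuity pushes the determinant below that bound.
  So no such points exist there, and the critical set is open.\<close>

theorem det_jacobian_nonzero:
  fixes F :: "complex ^ 'n \<Rightarrow> complex ^ 'n"
  assumes D: "open D" "\<And>i. line_holo (\<lambda>w. F w $ i) D" "inj_on F D"
    and "connected D" "bounded D" "z \<in> D"
  shows "det (complex_jacobian F z) \<noteq> 0"
proof -
  obtain M where M: "0 < M" "D \<subseteq> cball 0 M"
    using assms(5) by (auto simp: bounded_pos subset_iff)
  have cd: "continuous_on D (\<lambda>z. det (complex_jacobian F z))"
    by (rule line_holoD(1)[OF line_holo_det_jacobian[OF D(1,2)]])
  define A where "A = {z \<in> D. det (complex_jacobian F z) \<noteq> 0}"
  have "open A"
    using continuous_open_preimage[OF cd D(1), of "- {0}"]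
    by (simp add: A_def open_Compl vimage_def Int_def conj_commute)
  moreover have "open (D - A)"
    unfolding open_subopen[of "D - A"]
  proof
    fix y assume y: "y \<in> D - A"
    then have yD: "y \<in> D" and y0: "det (complex_jacobian F y) = 0" by (auto simp: A_def)
    obtain R where R: "0 < R" "cball (F y) R \<subseteq> F ` D"
      using open_injective_image[OF D] yD open_contains_cball by blast
    \<comment> \<open>For \<open>F u\<close> within \<open>R / 2\<close> of \<open>F y\<close>, the
      ball of radius \<open>R / 2\<close> about \<open>F u\<close> still lies in the image, so all
      such \<open>u\<close> share the constant \<open>c\<close>.\<close>
    define c where "c = fact CARD('n) * (2 * M / (R/2)) ^ CARD('n)"
    define N where "N = (D \<inter> F -` ball (F y) (R/2)) \<inter> (D \<inter> (\<lambda>z. c * cmod (det (complex_jacobian F z))) -` {..<1})"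
    have "open N"
      unfolding N_def
      by (intro open_Int continuous_open_preimage D(1) line_holo_continuous_on[OF D(2)] continuous_intros cd) auto
    moreover have "y \<in> N" using yD y0 R by (simp add: N_def)
    moreover have "N \<subseteq> D - A"
    proof
      fix u assume u: "u \<in> N"
      have "cball (F u) (R/2) \<subseteq> cball (F y) R"
      proof
        fix v assume "v \<in> cball (F u) (R/2)"
        then show "v \<in> cball (F y) R"
          using u dist_triangle[of "F y" v "F u"] by (auto simp: N_def)
      qed
      then have "1 \<le> c * cmod (det (complex_jacobian F u))" if "u \<in> A"
        unfolding c_def using that M R
        by (intro det_jacobian_lower_bound[OF D]) (auto simp: A_def)
      then show "u \<in> D - A" using u by (auto simp: N_def)
    qed
    ultimately show "\<exists>T. open T \<and> y \<in> T \<and> T \<subseteq> D - A" by blast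
  qed
  moreover have "A \<inter> D \<noteq> {}"
    using injective_imp_det_jacobian_nonzero_somewhere[OF D] assms(6) by (auto simp: A_def)
  ultimately have "(D - A) \<inter> D = {}"
    using connectedD[OF assms(4), of A "D - A"] by auto
  then show ?thesis using assms(6) by (auto simp: A_def)
qed

subsection \<open>Limits of injective holomorphic maps\<close>

lemma uniform_limit_prod_compact:
  fixes f :: "'i \<Rightarrow> nat \<Rightarrow> 'a::topological_space \<Rightarrow> complex"
  assumes "finite I" "compact K"
    and "\<And>i. i \<in> I \<Longrightarrow> uniform_limit K (f i) (l i) sequentially"
    and "\<And>i. i \<in> I \<Longrightarrow> continuous_on K (l i)"
  shows "uniform_limit K (\<lambda>n x. \<Prod>i\<in>I. f i n x) (\<lambda>x. \<Prod>i\<in>I. l i x) sequentially"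
  using assms(1,3,4)
proof induction
  case (insert i I)
  have "bounded (l i ` K)" "bounded ((\<lambda>x. \<Prod>i\<in>I. l i x) ` K)"
    by (intro compact_imp_bounded compact_continuous_image assms(2) continuous_on_prod insert.prems; simp)+
  with insert show ?case by (simp add: uniform_lim_mult)
qed (simp add: uniform_limit_const)

lemma uniform_limit_sum_finite:
  fixes f :: "'i \<Rightarrow> nat \<Rightarrow> 'a \<Rightarrow> 'b::real_normed_vector"
  assumes "finite I" "\<And>i. i \<in> I \<Longrightarrow> uniform_limit K (f i) (l i) sequentially"
  shows "uniform_limit K (\<lambda>n x. \<Sum>i\<in>I. f i n x) (\<lambda>x. \<Sum>i\<in>I. l i x) sequentially"
  using assms
proof induction
  case (insert i I)
  then show ?case by (simp add: uniform_limit_add)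
qed (simp add: uniform_limit_const)

lemma uniform_limit_det:
  fixes A :: "nat \<Rightarrow> 'a::topological_space \<Rightarrow> complex ^ 'n ^ 'n"
  assumes "compact K" "\<And>i j. uniform_limit K (\<lambda>n z. A n z $ i $ j) (\<lambda>z. B z $ i $ j) sequentially"
    and "\<And>i j. continuous_on K (\<lambda>z. B z $ i $ j)"
  shows "uniform_limit K (\<lambda>n z. det (A n z)) (\<lambda>z. det (B z)) sequentially"
  unfolding det_def
proof (rule uniform_limit_sum_finite)
  fix p :: "'n \<Rightarrow> 'n"
  have "uniform_limit K (\<lambda>n z. \<Prod>i\<in>UNIV. A n z $ i $ p i) (\<lambda>z. \<Prod>i\<in>UNIV. B z $ i $ p i) sequentially"
    by (rule uniform_limit_prod_compact) (use assms in auto)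
  then show "uniform_limit K (\<lambda>n z. of_int (sign p) * (\<Prod>i\<in>UNIV. A n z $ i $ p i))
      (\<lambda>z. of_int (sign p) * (\<Prod>i\<in>UNIV. B z $ i $ p i)) sequentially"
    by (rule bounded_linear.uniform_limit[OF bounded_linear_mult_right])
qed (simp add: finite_permutations)

text \<open>Cauchy's inequality is applied to the difference of \<open>\<phi> n\<close> and
  \<open>\<psi>\<close> on discs in direction \<open>u\<close> that stay in a compact thickening of
  \<open>K\<close>.\<close>

lemma uniform_limit_dirderiv:
  fixes \<phi> :: "nat \<Rightarrow> complex ^ 'n \<Rightarrow> complex"
  assumes "open D" "\<And>n. line_holo (\<phi> n) D" "line_holo \<psi> D"
    and lim: "\<And>K. compact K \<Longrightarrow> K \<subseteq> D \<Longrightarrow> uniform_limit K \<phi> \<psi> sequentially"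
    and "compact K" "K \<subseteq> D"
  shows "uniform_limit K (\<lambda>n. dirderiv (\<phi> n) u) (dirderiv \<psi> u) sequentially"
proof -
  obtain r where r: "r > 0" "(\<Union>x\<in>K. cball x r) \<subseteq> D"
    using compact_subset_open_imp_cball_epsilon_subset[OF assms(5,1,6)] by blast
  define K' where "K' = (\<Union>x\<in>K. cball x r)"
  have cK': "compact K'" unfolding K'_def by (rule compact_minkowski_sum_cball[OF assms(5)])
  have K'D: "K' \<subseteq> D" using r(2) by (simp add: K'_def)
  define \<delta> where "\<delta> = r / (norm u + 1)"
  have nu: "norm u + 1 > 0" by (simp add: add_nonneg_pos)
  then have \<delta>: "\<delta> > 0" using r(1) by (simp add: \<delta>_def)
  have inK': "z + s *s u \<in> K'" if "z \<in> K" "cmod s \<le> \<delta>" for z s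
  proof -
    have "cmod s * norm u \<le> \<delta> * (norm u + 1)" using that \<delta> by (intro mult_mono) auto
    also have "\<dots> = r" using nu by (simp add: \<delta>_def)
    finally have "z + s *s u \<in> cball z r" by (simp add: dist_norm norm_vector_smult)
    with that(1) show ?thesis unfolding K'_def by blast
  qed
  show ?thesis
  proof (rule uniform_limitI)
    fix e :: real assume e: "e > 0"
    \<comment> \<open>Cauchy's inequality divides this tolerance by \<open>\<delta>\<close>, leaving
      \<open>e / 2\<close>.\<close>
    have "\<forall>\<^sub>F n in sequentially. \<forall>w\<in>K'. dist (\<phi> n w) (\<psi> w) < e * \<delta> / 2"
      by (rule uniform_limitD[OF lim[OF cK' K'D]]) (use e \<delta> in simp)
    then show "\<forall>\<^sub>F n in sequentially. \<forall>z\<in>K. dist (dirderiv (\<phi> n) u z) (dirderiv \<psi> u z) < e"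
    proof eventually_elim
      case (elim n)
      show ?case
      proof
        fix z assume z: "z \<in> K"
        then have zD: "z \<in> D" using assms(6) by blast
        let ?h = "\<lambda>s. \<phi> n (z + s *s u) - \<psi> (z + s *s u)"
        have hol: "?h holomorphic_on {s. z + s *s u \<in> D}"
          by (intro holomorphic_intros line_holoD(2) assms)
        have sub: "cball 0 \<delta> \<subseteq> {s. z + s *s u \<in> D}"
          using inK'[OF z] K'D by auto
        have "(?h has_field_derivative dirderiv (\<phi> n) u z - dirderiv \<psi> u z) (at 0)"
          by (intro DERIV_diff dirderiv_line_0[OF assms(1)] assms(2,3) zD)
        then have "deriv ?h 0 = dirderiv (\<phi> n) u z - dirderiv \<psi> u z"
          by (rule DERIV_imp_deriv)
        moreover have "cmod ((deriv ^^ 1) ?h 0) \<le> fact 1 * (e * \<delta> / 2) / \<delta> ^ 1"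
        proof (rule Cauchy_inequality)
          show "?h holomorphic_on ball 0 \<delta>"
            by (rule holomorphic_on_subset[OF hol]) (use sub in force)
          show "continuous_on (cball 0 \<delta>) ?h"
            by (rule holomorphic_on_imp_continuous_on[OF holomorphic_on_subset[OF hol sub]])
          fix s :: complex assume "cmod (0 - s) = \<delta>"
          then show "cmod (?h s) \<le> e * \<delta> / 2"
            using elim inK'[OF z, of s] by (force simp: dist_norm)
        qed (rule \<delta>)
        ultimately have "cmod (dirderiv (\<phi> n) u z - dirderiv \<psi> u z) \<le> e / 2"
          using \<delta> by simp
        then show "dist (dirderiv (\<phi> n) u z) (dirderiv \<psi> u z) < e"
          using e by (simp add: dist_norm)
      qed
    qed
  qed
qed

lemma uniform_limit_component:
  "uniform_limit K F f sequentially \<Longrightarrow>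
    uniform_limit K (\<lambda>n z. (F n z :: complex ^ 'm) $ i) (\<lambda>z. f z $ i) sequentially"
  by (rule bounded_linear.uniform_limit[OF bounded_linear_vec_nth])

lemma line_holo_limit:
  assumes "open D" "\<And>n i. line_holo (\<lambda>w. F n w $ i) D"
    and lim: "\<And>K. compact K \<Longrightarrow> K \<subseteq> D \<Longrightarrow> uniform_limit K F f sequentially"
  shows "line_holo (\<lambda>w. (f w :: complex ^ 'm) $ i) D"
proof (rule line_holo_uniform_limit[OF assms(1)])
  fix a assume "a \<in> D"
  then obtain r where r: "r > 0" "cball a r \<subseteq> D" using assms(1) open_contains_cball by blast
  then show "\<exists>r>0. \<exists>Q. cball a r \<subseteq> D \<and> (\<forall>n::nat. line_holo (Q n) (cball a r)) \<and>
            uniform_limit (cball a r) Q (\<lambda>w. f w $ i) sequentially"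
    using line_holo_subset[OF assms(2) r(2)] uniform_limit_component[OF lim[OF compact_cball r(2)]]
    by (intro exI[of _ r] conjI exI[of _ "\<lambda>n w. F n w $ i"]) auto
qed

lemma uniform_limit_det_jacobian:
  fixes F :: "nat \<Rightarrow> complex ^ 'n \<Rightarrow> complex ^ 'n"
  assumes "open D" "\<And>n i. line_holo (\<lambda>w. F n w $ i) D"
    and lim: "\<And>K. compact K \<Longrightarrow> K \<subseteq> D \<Longrightarrow> uniform_limit K F f sequentially"
    and "compact K" "K \<subseteq> D"
  shows "uniform_limit K (\<lambda>n z. det (complex_jacobian (F n) z)) (\<lambda>z. det (complex_jacobian f z)) sequentially"
proof (rule uniform_limit_det[OF assms(4)])
  note lf = line_holo_limit[OF assms(1,2) lim]
  fix i j
  have "uniform_limit K (\<lambda>n. dirderiv (\<lambda>w. F n w $ i) (axis j 1)) (dirderiv (\<lambda>w. f w $ i) (axis j 1)) sequentially"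
    by (rule uniform_limit_dirderiv[OF assms(1,2) lf uniform_limit_component[OF lim] assms(4,5)])
  then show "uniform_limit K (\<lambda>n z. complex_jacobian (F n) z $ i $ j) (\<lambda>z. complex_jacobian f z $ i $ j) sequentially"
    by (simp add: complex_jacobian_def)
  show "continuous_on K (\<lambda>z. complex_jacobian f z $ i $ j)"
    using continuous_on_subset[OF line_holoD(1)[OF line_holo_dirderiv[OF assms(1) lf]] assms(5)]
    by (simp add: complex_jacobian_def)
qed

section \<open>Hurwitz's theorem in several variables\<close>

text \<open>Two points of a ball lie on a common complex line. If \<open>k\<close> vanished at just
  one of them it would be nonconstant on that line, and Hurwitz's theorem excludes the zero. So each
  ball in \<open>D\<close> is free of zeros or consists of zeros, and connectedness
  finishes.\<close>

lemma zero_free_limit_on_connected: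
  fixes h :: "nat \<Rightarrow> complex ^ 'n \<Rightarrow> complex"
  assumes "open D" "connected D" "\<And>n. line_holo (h n) D" "line_holo k D"
    and lim: "\<And>K. compact K \<Longrightarrow> K \<subseteq> D \<Longrightarrow> uniform_limit K h k sequentially"
    and nz: "\<And>n z. z \<in> D \<Longrightarrow> h n z \<noteq> 0"
    and "x \<in> D" "k x \<noteq> 0" "z \<in> D"
  shows "k z \<noteq> 0"
proof -
  have ball: "k c \<noteq> 0"
    if "ball a r \<subseteq> D" "b \<in> ball a r" "c \<in> ball a r" "k b \<noteq> 0" for a r b c
  proof
    assume kc: "k c = 0"
    \<comment> \<open>Parameters 0 and 1 give \<open>b\<close> and \<open>c\<close>; the section of
      a ball is convex, hence connected as Hurwitz's theorem demands.\<close>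
    define S where "S = {t. b + t *s (c - b) \<in> ball a r}"
    have "open S" unfolding S_def by (rule open_line) simp
    moreover have "convex S"
    proof -
      have "b + (u *\<^sub>R s + v *\<^sub>R t) *s (c - b) = u *\<^sub>R (b + s *s (c - b)) + v *\<^sub>R (b + t *s (c - b))"
        if "u + v = 1" for u v s t
      proof -
        have "u *\<^sub>R b + v *\<^sub>R b = b" using that by (simp flip: scaleR_add_left)
        then show ?thesis
          unfolding scaleR_add_right vector_sadd_rdistrib
          by (simp add: scaleR_eq_smult vector_smult_assoc scaleR_conv_of_real)
      qed
      then show ?thesis
        unfolding S_def by (intro convexI) (simp only: mem_Collect_eq convexD[OF convex_ball])
    qed
    moreover have S01: "0 \<in> S" "1 \<in> S" using that by (auto simp: S_def)
    have SD: "S \<subseteq> {t. b + t *s (c - b) \<in> D}" using that by (auto simp: S_def)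
    let ?l = "\<lambda>f t. f (b + t *s (c - b))"
    have "?l k 1 \<noteq> 0"
    proof (rule Hurwitz_no_zeros[where \<F>="\<lambda>n. ?l (h n)" and g="?l k"])
      show "open S" "connected S" by (fact, simp add: \<open>convex S\<close> convex_connected)
      show "?l (h n) holomorphic_on S" for n
        by (rule holomorphic_on_subset[OF line_holoD(2)[OF assms(3)] SD])
      show "?l k holomorphic_on S"
        by (rule holomorphic_on_subset[OF line_holoD(2)[OF assms(4)] SD])
      show "\<not> ?l k constant_on S"
      proof
        assume "?l k constant_on S"
        then obtain v where v: "\<And>t. t \<in> S \<Longrightarrow> ?l k t = v"
          unfolding constant_on_def by blast
        from v[OF S01(1)] v[OF S01(2)] kc that(4) show False by simp
      qed
      show "?l (h n) t \<noteq> 0" if "t \<in> S" for n t using nz SD that by blast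
      show "1 \<in> S" by (rule S01)
      fix K assume K: "compact K" "K \<subseteq> S"
      have "uniform_limit ((\<lambda>t. b + t *s (c - b)) ` K) h k sequentially"
        by (intro lim compact_continuous_image continuous_intros K) (use K SD in blast)
      then show "uniform_limit K (\<lambda>n. ?l (h n)) (?l k) sequentially"
        by (rule uniform_limit_compose') simp
    qed
    with kc show False by simp
  qed
  define A where "A = {z \<in> D. k z \<noteq> 0}"
  have "A \<subseteq> D" by (auto simp: A_def)
  have sub: "\<exists>r>0. ball y r \<subseteq> D \<and> (ball y r \<subseteq> A \<or> ball y r \<subseteq> D - A)"
    if yD: "y \<in> D" for y
  proof -
    obtain r where r: "r > 0" "ball y r \<subseteq> D" using assms(1) yD open_contains_ball by blast
    have "ball y r \<subseteq> A \<or> ball y r \<subseteq> D - A"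
    proof (cases "\<exists>b\<in>ball y r. k b \<noteq> 0")
      case True
      then obtain b where b: "b \<in> ball y r" "k b \<noteq> 0" by blast
      have "ball y r \<subseteq> A"
      proof
        fix c assume c: "c \<in> ball y r"
        then have "k c \<noteq> 0" using ball[OF r(2) b(1)] b(2) by blast
        with c r(2) show "c \<in> A" by (auto simp: A_def)
      qed
      then show ?thesis ..
    next
      case False
      then show ?thesis using r(2) by (auto simp: A_def)
    qed
    with r show ?thesis by blast
  qed
  have "open A" "open (D - A)"
    unfolding open_contains_ball
  proof safe
    fix y assume "y \<in> A"
    then obtain r where r: "r > 0" "ball y r \<subseteq> A \<or> ball y r \<subseteq> D - A"
      using sub \<open>A \<subseteq> D\<close> by blast
    moreover have "y \<in> ball y r" using r by simp
    ultimately show "\<exists>e>0. ball y e \<subseteq> A" using \<open>y \<in> A\<close> by blast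
  next
    fix y assume "y \<in> D" "y \<notin> A"
    then obtain r where r: "r > 0" "ball y r \<subseteq> A \<or> ball y r \<subseteq> D - A"
      using sub by blast
    moreover have "y \<in> ball y r" using r by simp
    ultimately show "\<exists>e>0. ball y e \<subseteq> D - A" using \<open>y \<notin> A\<close> by blast
  qed
  then have "(D - A) \<inter> D = {}"
    using connectedD[OF assms(2), of A "D - A"] assms(7,8) by (auto simp: A_def)
  then show ?thesis using assms(9) by (auto simp: A_def)
qed

section \<open>Brouwer's theorem and failure of injectivity\<close>

text \<open>A Newton map with the inverse of \<open>A\<close> frozen has the solutions of
  \<open>F n z = F n b\<close> as fixed points. Since \<open>f a = f b\<close>, for suitable large
  \<open>n\<close> it maps a small closed ball around \<open>a\<close> that misses \<open>b\<close>
  into itself.\<close>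

lemma uniform_limit_not_inj_on:
  fixes F :: "nat \<Rightarrow> complex ^ 'n \<Rightarrow> complex ^ 'n"
  assumes "open D" "\<And>n. continuous_on D (F n)"
    and lim: "\<And>K. compact K \<Longrightarrow> K \<subseteq> D \<Longrightarrow> uniform_limit K F f sequentially"
    and der: "(f has_derivative (*v) A) (at a)" and "det A \<noteq> 0"
    and "a \<in> D" "b \<in> D" "a \<noteq> b" "f a = f b"
  shows "\<exists>n. \<not> inj_on (F n) D"
proof -
  obtain E where E: "E ** A = mat 1" "A ** E = mat 1"
    using assms(5) invertible_det_nz[of A] by (auto simp: invertible_def)
  have blE: "bounded_linear ((*v) E)" by simp
  obtain B where B: "B > 0" "\<And>v. norm (E *v v) \<le> B * norm v"
    using bounded_linear.pos_bounded[OF blE] by (metis mult.commute)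
  \<comment> \<open>After applying \<open>E\<close>, which costs a factor \<open>B\<close>, the
    linearisation error is at most half the radius.\<close>
  obtain d where d: "d > 0" "\<And>z. norm (z - a) < d \<Longrightarrow> norm (f z - f a - A *v (z - a)) \<le> 1 / (2 * B) * norm (z - a)"
    using conjunct2[OF der[unfolded has_derivative_at_alt], rule_format, of "1 / (2 * B)"] B(1) by auto
  obtain r where r: "r > 0" "cball a r \<subseteq> D" using assms(1,6) open_contains_cball by blast
  \<comment> \<open>The three terms keep the ball inside \<open>D\<close>, within reach of the
    linearisation, and away from \<open>b\<close>.\<close>
  define \<rho> where "\<rho> = min r (min (d / 2) (dist a b / 2))"
  have \<rho>: "\<rho> > 0" "\<rho> < d" "\<rho> < dist a b" "cball a \<rho> \<subseteq> D"
    using r d(1) assms(8) zero_less_dist_iff[of a b] by (auto simp: \<rho>_def subset_iff min_def)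
  \<comment> \<open>The point \<open>b\<close> is added because \<open>F n b\<close> must be close
    to \<open>f b\<close> too.\<close>
  define K where "K = insert b (cball a \<rho>)"
  have K: "compact K" "K \<subseteq> D" using \<rho> assms(7) by (auto simp: K_def)
  \<comment> \<open>The approximation errors at \<open>z\<close> and at \<open>b\<close> each cost
    \<open>\<rho> / 4\<close> after applying \<open>E\<close>; with the linearisation error the
    total is \<open>\<rho>\<close>.\<close>
  have "\<forall>\<^sub>F n in sequentially. \<forall>z\<in>K. dist (F n z) (f z) < \<rho> / (4 * B)"
    by (rule uniform_limitD[OF lim[OF K]]) (use \<rho> B in simp)
  then obtain n where n: "\<And>z. z \<in> K \<Longrightarrow> dist (F n z) (f z) < \<rho> / (4 * B)"
    by (auto simp: eventually_sequentially)
  define T where "T z = z - E *v (F n z - F n b)" for z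
  obtain z where z: "z \<in> cball a \<rho>" "T z = z"
  proof (rule brouwer_ball[OF \<rho>(1)])
    show "continuous_on (cball a \<rho>) T"
      unfolding T_def
      by (intro continuous_intros bounded_linear.continuous_on[OF blE] continuous_on_subset[OF assms(2) \<rho>(4)])
    show "T \<in> cball a \<rho> \<rightarrow> cball a \<rho>"
    proof
      fix z assume z: "z \<in> cball a \<rho>"
      let ?u = "f z - f a - A *v (z - a)" and ?v = "F n z - f z" and ?w = "F n b - f b"
      have "E *v (A *v (z - a)) = z - a" by (simp add: matrix_vector_mul_assoc E)
      moreover have "F n z - F n b = ?u + A *v (z - a) + ?v - ?w" using assms(9) by simp
      ultimately have "T z - a = - (E *v ?u) - E *v ?v + E *v ?w"
        unfolding T_def by (simp only: matrix_vector_right_distrib matrix_vector_mult_diff_distrib) simp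
      then have "norm (T z - a) \<le> norm (E *v ?u) + norm (E *v ?v) + norm (E *v ?w)"
        using norm_triangle_ineq[of "- (E *v ?u) - E *v ?v" "E *v ?w"]
          norm_triangle_ineq4[of "- (E *v ?u)" "E *v ?v"] by simp
      also have "\<dots> \<le> \<rho> / 2 + \<rho> / 4 + \<rho> / 4"
      proof (intro add_mono)
        have "norm (z - a) \<le> \<rho>" using z by (simp add: dist_norm norm_minus_commute)
        moreover have "norm ?u \<le> 1 / (2 * B) * norm (z - a)"
          using d(2)[of z] \<open>norm (z - a) \<le> \<rho>\<close> \<rho>(2) by linarith
        moreover have "1 / (2 * B) * norm (z - a) \<le> 1 / (2 * B) * \<rho>"
          using B(1) \<open>norm (z - a) \<le> \<rho>\<close> by (intro mult_left_mono) auto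
        ultimately have "norm ?u \<le> 1 / (2 * B) * \<rho>" by linarith
        then have "B * norm ?u \<le> B * (1 / (2 * B) * \<rho>)" using B(1) by (intro mult_left_mono) auto
        then show "norm (E *v ?u) \<le> \<rho> / 2" using B(2)[of ?u] B(1) by simp
        have small: "norm (E *v (F n y - f y)) \<le> \<rho> / 4" if "y \<in> K" for y
        proof -
          have "B * norm (F n y - f y) \<le> B * (\<rho> / (4 * B))"
            using n[OF that] B(1) by (intro mult_left_mono) (auto simp: dist_norm)
          then show ?thesis using B(2)[of "F n y - f y"] B(1) by simp
        qed
        show "norm (E *v ?v) \<le> \<rho> / 4" "norm (E *v ?w) \<le> \<rho> / 4"
          using small[of z] small[of b] z by (simp_all add: K_def)
      qed
      finally show "T z \<in> cball a \<rho>" by (simp add: dist_norm norm_minus_commute)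
    qed
  qed
  have "E *v (F n z - F n b) = 0" using z(2) by (simp add: T_def)
  then have "A *v (E *v (F n z - F n b)) = 0" by simp
  then have "F n z = F n b" by (simp add: matrix_vector_mul_assoc E)
  moreover have "z \<noteq> b" "z \<in> D" using z(1) \<rho> by auto
  ultimately show ?thesis using assms(7) by (auto simp: inj_on_def)
qed

section \<open>Injectivity of the limit\<close>

theorem theorem2p2:
  fixes D :: "(complex ^ 'n) set" and x :: "complex ^ 'n"
    and F :: "nat \<Rightarrow> complex ^ 'n \<Rightarrow> complex ^ 'n" and f :: "complex ^ 'n \<Rightarrow> complex ^ 'n"
  assumes "domain_set D" and "bounded D" and "x \<in> D"
    and "\<And>i. holomorphic_map_on (F i) D"
    and "\<And>i. inj_on (F i) D"
    and "\<And>i. F i x = 0"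
    and "\<And>K. compact K \<Longrightarrow> K \<subseteq> D \<Longrightarrow> uniform_limit K F f sequentially"
    and "\<exists>U. 0 \<in> interior U \<and> (\<forall>i. U \<subseteq> F i ` D)"
  shows "inj_on f D"
proof (rule inj_onI, rule ccontr)
  have D: "open D" "connected D" using assms(1) by (auto simp: domain_set_def)
  have lF: "line_holo (\<lambda>w. F n w $ i) D" for n i
    by (rule holomorphic_map_on_line_holo[OF D(1) assms(4)])
  have lf: "line_holo (\<lambda>w. f w $ i) D" for i
    by (rule line_holo_limit[where F=F, OF D(1) lF assms(7)])
  have lim: "uniform_limit K (\<lambda>n z. det (complex_jacobian (F n) z)) (\<lambda>z. det (complex_jacobian f z)) sequentially"
    if K: "compact K" "K \<subseteq> D" for K
    by (rule uniform_limit_det_jacobian[where F=F, OF D(1) lF assms(7) K])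
  have nz: "det (complex_jacobian (F n) z) \<noteq> 0" if "z \<in> D" for n z
    by (rule det_jacobian_nonzero[where F="F n", OF D(1) lF assms(5) D(2) assms(2) that])
  obtain M where M: "0 < M" "D \<subseteq> cball 0 M"
    using assms(2) by (auto simp: bounded_pos subset_iff)
  obtain U where U: "0 \<in> interior U" "\<And>n. U \<subseteq> F n ` D" using assms(8) by blast
  obtain R where R0: "0 < R" "cball 0 R \<subseteq> interior U"
    using U(1) open_contains_cball[of "interior U"] by auto
  have R: "0 < R" "cball 0 R \<subseteq> F n ` D" for n
    using R0 interior_subset[of U] U(2)[of n] by auto
  \<comment> \<open>As \<open>F n x = 0\<close>, the same ball \<open>cball 0 R\<close> is centred
    at the image of \<open>x\<close> for every \<open>n\<close>, so \<open>c\<close> does not depend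
    on \<open>n\<close>.\<close>
  define c where "c = fact CARD('n) * (2 * M / R) ^ CARD('n)"
  have "(\<lambda>n. c * cmod (det (complex_jacobian (F n) x))) \<longlonglongrightarrow> c * cmod (det (complex_jacobian f x))"
    by (intro tendsto_intros tendsto_uniform_limitI[OF lim[of "{x}"]]) (use assms(3) in auto)
  moreover have "1 \<le> c * cmod (det (complex_jacobian (F n) x))" for n
    unfolding c_def using M R assms(3,6)
    by (intro det_jacobian_lower_bound[where F="F n" and D=D, OF D(1) lF assms(5)] nz) auto
  ultimately have "1 \<le> c * cmod (det (complex_jacobian f x))"
    by (intro LIMSEQ_le_const) auto
  then have fx: "det (complex_jacobian f x) \<noteq> 0" by auto
  \<comment> \<open>Hurwitz's theorem carries nonvanishing from \<open>x\<close> to all of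
    \<open>D\<close>, in particular to the point \<open>a\<close> below, where the Brouwer argument
    uses an invertible derivative.\<close>
  have nzf: "det (complex_jacobian f z) \<noteq> 0" if "z \<in> D" for z
    by (rule zero_free_limit_on_connected[where h="\<lambda>n z. det (complex_jacobian (F n) z)" and k="\<lambda>z. det (complex_jacobian f z)",
          OF D line_holo_det_jacobian[OF D(1) lF] line_holo_det_jacobian[OF D(1) lf] lim nz assms(3) fx that])
  fix a b assume ab: "a \<in> D" "b \<in> D" "f a = f b" "a \<noteq> b"
  have "\<exists>n. \<not> inj_on (F n) D"
    by (rule uniform_limit_not_inj_on[where F=F and f=f, OF D(1) line_holo_continuous_on[OF lF] assms(7)
        complex_jacobian_has_derivative[OF D(1) lf ab(1)] nzf[OF ab(1)] ab(1,2,4,3)])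
  with assms(5) show False by blast
qed

end
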